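(* Let $G$ be a finite cyclic group of order $n$. If the proper power graph $P^\ast(G)$ is connected, then the center of $P^\ast(G)$ is a complete graph (i.e. any two distinct vertices in the center are adjacent).
   Context: The power graph $P(G)$ of a group $G$ is the simple undirected graph with vertex set $G$ in which two distinct vertices $a,b$ are adjacent if and only if $a\in\langle b\rangle$ or $b\in\langle a\rangle$. The proper power graph $P^\ast(G)$ is the graph obtained from $P(G)$ by deleting the vertex corresponding to the identity element. The eccentricity of a vertex is the greatest distance from that vertex to any other vertex of the graph. The center of a graph is the subgraph induced by the vertices of minimum eccentricity. *)

theory Defs
  imports "HOL-Algebra.Elementary_Groups" "Graph_Theory.Graph_Theory"
begin

text \<open>A simple undirected graph is a digraph satisfying the locale \<open>graph\<close>: finite,
  symmetric, without loops and without parallel arcs.\<close>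

definition power_graph :: "('a, 'm) monoid_scheme \<Rightarrow> ('a, 'a \<times> 'a) pre_digraph" where
  "power_graph G = with_proj
     \<lparr> pverts = carrier G,
       parcs = {(a, b). a \<in> carrier G \<and> b \<in> carrier G \<and> a \<noteq> b \<and>
                 (a \<in> generate G {b} \<or> b \<in> generate G {a})} \<rparr>"

definition proper_power_graph :: "('a, 'm) monoid_scheme \<Rightarrow> ('a, 'a \<times> 'a) pre_digraph" where
  "proper_power_graph G = pre_digraph.del_vert (power_graph G) \<one>\<^bsub>G\<^esub>"

context wf_digraph
begin

text \<open>With unit weights the library's weighted distance counts arcs; it is
  infinite for vertices not joined by a walk.\<close>

definition distance :: "'a \<Rightarrow> 'a \<Rightarrow> ereal" where
  "distance u v = \<mu> (\<lambda>_. 1) u v"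

text \<open>The supremum also ranges over \<open>u\<close> itself, at distance 0. This only matters in the
  one-vertex graph, whose vertex thereby gets eccentricity 0. In a finite graph the supremum
  is a maximum.\<close>

definition eccentricity :: "'a \<Rightarrow> ereal" where
  "eccentricity u = (SUP v \<in> verts G. distance u v)"

definition center :: "('a, 'b) pre_digraph" where
  "center = G \<restriction> {u \<in> verts G. \<forall>v \<in> verts G. eccentricity u \<le> eccentricity v}"

end

definition complete_graph :: "('a, 'b) pre_digraph \<Rightarrow> bool" where
  "complete_graph H \<longleftrightarrow> complete_digraph (card (verts H)) H"

text \<open>Distance, eccentricity and center are defined in the locale \<open>wf_digraph\<close>, so the graphs they are
  applied to have to be well-formed.\<close>

lemma wf_digraph_power_graph: "wf_digraph (power_graph G)"
  by unfold_locales (auto simp: power_graph_def)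

lemma wf_digraph_proper_power_graph: "wf_digraph (proper_power_graph G)"
  unfolding proper_power_graph_def
  by (rule wf_digraph.wf_digraph_del_vert[OF wf_digraph_power_graph])

lemma verts_proper_power_graph: "verts (proper_power_graph G) = carrier G - {\<one>\<^bsub>G\<^esub>}"
  by (simp add: proper_power_graph_def pre_digraph.verts_del_vert power_graph_def)

lemma arcs_ends_proper_power_graph:
  "arcs_ends (proper_power_graph G) =
     {(a, b). a \<in> carrier G - {\<one>\<^bsub>G\<^esub>} \<and> b \<in> carrier G - {\<one>\<^bsub>G\<^esub>} \<and> a \<noteq> b \<and>
        (a \<in> generate G {b} \<or> b \<in> generate G {a})}"
  by (auto simp: arcs_ends_conv proper_power_graph_def pre_digraph.arcs_del_vert
      pre_digraph.tail_del_vert pre_digraph.head_del_vert power_graph_def image_iff)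

lemma graph_proper_power_graph:
  assumes "finite (carrier G)"
  shows "graph (proper_power_graph G)"
proof -
  interpret wf_digraph "proper_power_graph G" by (rule wf_digraph_proper_power_graph)
  have "arcs (proper_power_graph G) \<subseteq> carrier G \<times> carrier G"
    by (auto simp: proper_power_graph_def pre_digraph.arcs_del_vert power_graph_def)
  then have "finite (arcs (proper_power_graph G))"
    using assms by (blast intro: finite_subset finite_cartesian_product)
  moreover have "finite (verts (proper_power_graph G))"
    using assms by (simp add: verts_proper_power_graph)
  moreover have "symmetric (proper_power_graph G)"
    unfolding symmetric_def arcs_ends_proper_power_graph by (rule symI) auto
  ultimately show ?thesis
    by unfold_locales
      (auto simp: arc_to_ends_def proper_power_graph_def pre_digraph.del_vert_simps
        power_graph_def)
qed

end

theory Submission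
  imports Defs
begin

text \<open>Let \<open>g\<close> generate the group. Connectedness makes the vertex set nonempty, so
  the group is nontrivial and \<open>g\<close> survives the removal of the identity. Every element
  lies in the subgroup generated by \<open>g\<close>, so \<open>g\<close> is adjacent to all other
  vertices and has eccentricity at most 1. By minimality each central vertex also has eccentricity
  at most 1, hence is adjacent to all other vertices (\<open>eccentricity_le_1_iff\<close>), in
  particular to the other central ones. \<open>complete_graph_center\<close> carries this out for
  any graph with a dominating vertex.\<close>

lemma (in graph) graph_induce_subgraph: "vs \<subseteq> verts G \<Longrightarrow> graph (G \<restriction> vs)"
  by (metis digraph.axioms digraphI_induced graph_def induced_graph_imp_graph induced_induce
      pseudo_graph.intro)

context wf_digraph
begin

lemma distance_self:
  assumes "u \<in> verts G"
  shows "distance u u \<le> 0"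
  using min_cost_le_walk_cost[of u "[]" u "\<lambda>_. 1"] assms
  by (simp add: distance_def awalk_Nil_iff zero_ereal_def)

lemma distance_le_1_of_dominates:
  assumes "u \<rightarrow> v"
  shows "distance u v \<le> 1"
proof -
  obtain e where "e \<in> arcs G" "u = tail G e" "v = head G e"
    using assms by (auto simp: arcs_ends_conv)
  then show ?thesis
    using min_cost_le_walk_cost[of u "[e]" v "\<lambda>_. 1"] arc_implies_awalk
    by (simp add: distance_def one_ereal_def)
qed

text \<open>Between distinct non-adjacent vertices every walk has at least two arcs, so the infimum
  of the costs is at least 2. If there is no walk, the infimum is infinite and the bound still
  holds.\<close>

lemma dominates_of_distance_le_1:
  assumes "distance u v \<le> 1" and "u \<noteq> v"
  shows "u \<rightarrow> v"
proof (rule ccontr)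
  assume "\<not> u \<rightarrow> v"
  have "ereal 2 \<le> ereal (awalk_cost (\<lambda>_. 1) p)" if p: "awalk u p v" for p
  proof -
    have "p \<noteq> []"
      using p \<open>u \<noteq> v\<close> by (auto simp: awalk_Nil_iff)
    moreover have "p \<noteq> [e]" for e
      using p \<open>\<not> u \<rightarrow> v\<close> by (auto simp: awalk_simps arcs_ends_conv)
    ultimately obtain e f q where "p = e # f # q"
      by (metis neq_Nil_conv)
    then show ?thesis
      by (simp add: awalk_cost_def sum_list_triv)
  qed
  then have "ereal 2 \<le> distance u v"
    unfolding distance_def \<mu>_def by (auto intro: INF_greatest)
  also have "\<dots> \<le> ereal 1"
    using assms by (simp add: one_ereal_def)
  finally show False
    by simp
qed

text \<open>The bound is an inequality so that the one-vertex graph, with eccentricity 0, is covered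
  as well.\<close>

lemma eccentricity_le_1_iff:
  assumes "u \<in> verts G"
  shows "eccentricity u \<le> 1 \<longleftrightarrow> (\<forall>v \<in> verts G. u \<noteq> v \<longrightarrow> u \<rightarrow> v)"
proof
  assume "eccentricity u \<le> 1"
  then show "\<forall>v \<in> verts G. u \<noteq> v \<longrightarrow> u \<rightarrow> v"
    by (auto simp: eccentricity_def SUP_le_iff intro: dominates_of_distance_le_1)
next
  assume "\<forall>v \<in> verts G. u \<noteq> v \<longrightarrow> u \<rightarrow> v"
  then have "distance u v \<le> 1" if "v \<in> verts G" for v
    using that distance_self[OF assms] distance_le_1_of_dominates
    by (cases "u = v") (auto intro: order_trans)
  then show "eccentricity u \<le> 1"
    by (auto simp: eccentricity_def SUP_le_iff)
qed

end

lemma (in graph) complete_graph_center: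
  assumes "c \<in> verts G" and "\<And>v. v \<in> verts G \<Longrightarrow> c \<noteq> v \<Longrightarrow> c \<rightarrow> v"
  shows "complete_graph center"
proof -
  define C where "C = {u \<in> verts G. \<forall>v \<in> verts G. eccentricity u \<le> eccentricity v}"
  have C: "center = G \<restriction> C" "C \<subseteq> verts G"
    by (auto simp: center_def C_def)
  have "eccentricity c \<le> 1"
    using assms by (simp add: eccentricity_le_1_iff)
  \<comment> \<open>Minimality compares \<open>u\<close> with \<open>c\<close>: the eccentricity of
    \<open>u\<close> is at most that of \<open>c\<close>, hence at most 1.\<close>
  then have adj: "u \<rightarrow> v" if "u \<in> C" "v \<in> verts G" "u \<noteq> v" for u v
    using that assms(1) eccentricity_le_1_iff[of u] by (force simp: C_def)
  interpret H: graph "G \<restriction> C"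
    using C(2) by (rule graph_induce_subgraph)
  have "arcs_ends (G \<restriction> C) = {(u, v). (u, v) \<in> C \<times> C \<and> u \<noteq> v}"
  proof (intro equalityI subsetI)
    fix x assume "x \<in> arcs_ends (G \<restriction> C)"
    then show "x \<in> {(u, v). (u, v) \<in> C \<times> C \<and> u \<noteq> v}"
      using no_loops by (auto simp: arcs_ends_conv)
  next
    fix x assume "x \<in> {(u, v). (u, v) \<in> C \<times> C \<and> u \<noteq> v}"
    then obtain u v where "x = (u, v)" "u \<in> C" "v \<in> C" "u \<noteq> v"
      by auto
    moreover from this obtain e where "e \<in> arcs G" "u = tail G e" "v = head G e"
      using adj C(2) by (force simp: arcs_ends_conv)
    ultimately show "x \<in> arcs_ends (G \<restriction> C)"
      by (auto simp: arcs_ends_conv)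
  qed
  then show ?thesis
    using H.graph_axioms by (simp add: complete_graph_def complete_digraph_def C(1))
qed

theorem theorem3p11:
  fixes G :: "('a, 'm) monoid_scheme" and n :: nat
  assumes "group G" and "cyclic_group G" and "finite (carrier G)" and "order G = n"
    and "Digraph_Component.connected (proper_power_graph G)"
  shows "complete_graph (wf_digraph.center (proper_power_graph G))"
proof -
  interpret group G by fact
  let ?P = "proper_power_graph G"
  interpret P: graph ?P
    using assms(3) by (rule graph_proper_power_graph)
  obtain g where g: "g \<in> carrier G" "carrier G = range (\<lambda>k::int. g [^]\<^bsub>G\<^esub> k)"
    using assms(2) by (auto simp: cyclic_group)
  then have gen: "generate G {g} = carrier G"
    by (auto simp: generate_pow)
  have "verts ?P \<noteq> {}"
    using assms(5) by (auto simp: Digraph_Component.connected_def strongly_connected_def)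
  \<comment> \<open>Otherwise the carrier would be generated by the identity, hence trivial, leaving
    no vertex.\<close>
  then have "g \<noteq> \<one>\<^bsub>G\<^esub>"
    using gen by (auto simp: verts_proper_power_graph generate_one)
  with g(1) gen show ?thesis
    by (intro P.complete_graph_center[of g])
      (auto simp: verts_proper_power_graph arcs_ends_proper_power_graph)
qed

end
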